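(* Let $A$ be a finite alphabet with $|A|\ge 2$ and let $L$ be a left ideal of $A^*$. Then the following conditions are equivalent: (i) $\tau_L\in\mathrm{RC}(A^{-\omega})$; (ii) $\tau_L\in\mathrm{PRC}(A^{-\omega})$; (iii) $L$ is a two-sided ideal of $A^*$; (iv) $(L\beta_{\ell})A\subseteq A^*(L\beta_{\ell})$; (v) $L\beta_{\ell}$ is a semaphore code.
   Context: $A^*$ is the free monoid on $A$. A left ideal of $A^*$ is a subset $L$ with $A^*L\subseteq L$; an ideal is a subset $I$ with $A^*IA^*\subseteq I$ (the empty set is allowed). Suffix order on $A^*$: $u\le_s v$ iff $v\in A^*u$. For a left ideal $L$, $L\beta_\ell$ is the set of $\le_s$-minimal elements of $L$. A suffix code is an antichain for $\le_s$. $S\subseteq A^*$ is a semaphore code if it is a suffix code and $SA\subseteq A^*S$. $A^{-\omega}$ is the set of left infinite words $\cdots a_3a_2a_1$ ($a_i\in A$); for $x\in A^{-\omega}$ and $u\in A^*$, $xu\in A^{-\omega}$ is the concatenation. The suffix metric on $A^{-\omega}$ is $d(x,y)=2^{-|\mathrm{lcs}(x,y)|}$ for $x\ne y$, where $\mathrm{lcs}(x,y)$ is the longest common suffix, and $d(x,x)=0$; $A^{-\omega}\times A^{-\omega}$ carries the product (max) metric. A right congruence on $A^{-\omega}$ is an equivalence relation $\rho$ such that $(x,y)\in\rho$ implies $(xu,yu)\in\rho$ for all $u\in A^*$; $\mathrm{RC}(A^{-\omega})$ is the set of these. $\rho$ is open if it is an open subset of $A^{-\omega}\times A^{-\omega}$.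 $\rho$ is profinite if it is an intersection of open right congruences; $\mathrm{PRC}(A^{-\omega})$ is the set of profinite right congruences. For $P\subseteq A^*$, the relation $\tau_P$ on $A^{-\omega}$ is: $x\,\tau_P\,y$ iff $x=y$ or $x,y\in A^{-\omega}u$ for some $u\in P$. *)

theory Defs
  imports "HOL-Analysis.Analysis" "HOL-Library.Sublist"
begin

text \<open>
  The alphabet is a type \<open>'a\<close>, the free monoid over it is \<open>'a list\<close>, and the order \<open>\<le>\<^sub>s\<close> is
  \<^const>\<open>suffix\<close>.
\<close>

section \<open>Languages of finite words\<close>

definition lang_prod :: "'a list set \<Rightarrow> 'a list set \<Rightarrow> 'a list set" (infixl "\<odot>" 75)
  where "X \<odot> Y = {u @ v | u v. u \<in> X \<and> v \<in> Y}"

definition letters :: "'a list set"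
  where "letters = range (\<lambda>a. [a])"

definition left_ideal :: "'a list set \<Rightarrow> bool"
  where "left_ideal L \<longleftrightarrow> UNIV \<odot> L \<subseteq> L"

definition two_sided_ideal :: "'a list set \<Rightarrow> bool"
  where "two_sided_ideal I \<longleftrightarrow> UNIV \<odot> I \<odot> UNIV \<subseteq> I"

definition suffix_minimal :: "'a list set \<Rightarrow> 'a list set"
  where "suffix_minimal L = {u \<in> L. \<forall>v\<in>L. suffix v u \<longrightarrow> v = u}"

definition suffix_code :: "'a list set \<Rightarrow> bool"
  where "suffix_code S \<longleftrightarrow> (\<forall>u\<in>S. \<forall>v\<in>S. suffix u v \<longrightarrow> u = v)"

definition semaphore_code :: "'a list set \<Rightarrow> bool"
  where "semaphore_code S \<longleftrightarrow> suffix_code S \<and> S \<odot> letters \<subseteq> UNIV \<odot> S"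

section \<open>Left infinite words\<close>

text \<open>The word \<open>\<dots>a\<^sub>3a\<^sub>2a\<^sub>1\<close> is encoded by \<open>x i = a\<^sub>i\<^sub>+\<^sub>1\<close>: index \<open>0\<close> is the rightmost letter.\<close>

type_synonym 'a linf = "nat \<Rightarrow> 'a"

definition linf_append :: "'a linf \<Rightarrow> 'a list \<Rightarrow> 'a linf" (infixl "\<cdot>" 65)
  where "x \<cdot> u = (\<lambda>i. if i < length u then rev u ! i else x (i - length u))"

lemma linf_append_append: "x \<cdot> u \<cdot> v = x \<cdot> (u @ v)"
  by (auto simp: linf_append_def fun_eq_iff nth_append add.commute)

text \<open>The set \<open>A\<^sup>-\<^sup>\<omega>u\<close>.\<close>

definition ending_in :: "'a list \<Rightarrow> 'a linf set"
  where "ending_in u = range (\<lambda>x. x \<cdot> u)"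

lemma ending_in_iff: "x \<in> ending_in u \<longleftrightarrow> (\<forall>i<length u. x i = rev u ! i)"
proof
  assume r: "\<forall>i<length u. x i = rev u ! i"
  have "x = (\<lambda>i. x (i + length u)) \<cdot> u"
    using r by (auto simp: linf_append_def fun_eq_iff)
  then show "x \<in> ending_in u"
    unfolding ending_in_def by blast
qed (auto simp: ending_in_def linf_append_def)

section \<open>The suffix metric\<close>

text \<open>Only meaningful for \<open>x \<noteq> y\<close>; otherwise there is no longest common suffix among the finite words.\<close>

definition lcs :: "'a linf \<Rightarrow> 'a linf \<Rightarrow> 'a list"
  where "lcs x y = (ARG_MAX length u. x \<in> ending_in u \<and> y \<in> ending_in u)"

definition suffix_dist :: "'a linf \<Rightarrow> 'a linf \<Rightarrow> real"
  where "suffix_dist x y = (if x = y then 0 else (1 / 2) ^ length (lcs x y))"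

lemma common_suffix_iff:
  "(\<exists>u. length u = n \<and> x \<in> ending_in u \<and> y \<in> ending_in u) \<longleftrightarrow> (\<forall>i<n. x i = y i)"
proof
  assume r: "\<forall>i<n. x i = y i"
  let ?u = "rev (map x [0..<n])"
  have "length ?u = n \<and> x \<in> ending_in ?u \<and> y \<in> ending_in ?u"
    using r by (auto simp: ending_in_iff)
  then show "\<exists>u. length u = n \<and> x \<in> ending_in u \<and> y \<in> ending_in u"
    by blast
qed (auto simp: ending_in_iff)

lemma lcs_props:
  assumes "x \<noteq> y"
  shows "x \<in> ending_in (lcs x y)" "y \<in> ending_in (lcs x y)"
    and "\<And>u. x \<in> ending_in u \<Longrightarrow> y \<in> ending_in u \<Longrightarrow> length u \<le> length (lcs x y)"
proof -
  obtain n where n: "x n \<noteq> y n"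
    using assms by (auto simp: fun_eq_iff)
  let ?P = "\<lambda>u. x \<in> ending_in u \<and> y \<in> ending_in u"
  have "?P []"
    by (simp add: ending_in_iff)
  moreover have "\<forall>u. ?P u \<longrightarrow> length u < Suc n"
    using n by (metis ending_in_iff less_Suc_eq_le not_le_imp_less)
  ultimately have "?P (lcs x y) \<and> (\<forall>u. ?P u \<longrightarrow> length u \<le> length (lcs x y))"
    unfolding lcs_def by (rule arg_max_nat_lemma)
  then show "x \<in> ending_in (lcs x y)" "y \<in> ending_in (lcs x y)"
    "\<And>u. x \<in> ending_in u \<Longrightarrow> y \<in> ending_in u \<Longrightarrow> length u \<le> length (lcs x y)"
    by blast+
qed

lemma le_length_lcs_iff:
  assumes "x \<noteq> y"
  shows "n \<le> length (lcs x y) \<longleftrightarrow> (\<forall>i<n. x i = y i)"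
proof
  assume "n \<le> length (lcs x y)"
  then show "\<forall>i<n. x i = y i"
    using lcs_props(1,2)[OF assms] by (auto simp: ending_in_iff)
next
  assume "\<forall>i<n. x i = y i"
  then show "n \<le> length (lcs x y)"
    using lcs_props(3)[OF assms] common_suffix_iff[of n x y] by blast
qed

lemma suffix_dist_le_iff: "suffix_dist x y \<le> (1 / 2) ^ n \<longleftrightarrow> (\<forall>i<n. x i = y i)"
proof (cases "x = y")
  case False
  then show ?thesis
    using le_length_lcs_iff[OF False, of n] by (simp add: suffix_dist_def power_decreasing_iff)
qed (simp add: suffix_dist_def)

lemma suffix_dist_ultrametric: "suffix_dist x z \<le> max (suffix_dist x y) (suffix_dist y z)"
proof (cases "x = y \<or> y = z")
  case False
  define n where "n = min (length (lcs x y)) (length (lcs y z))"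
  have "\<forall>i<n. x i = z i"
    using False le_length_lcs_iff[of x y n] le_length_lcs_iff[of y z n] by (auto simp: n_def)
  then have "suffix_dist x z \<le> (1 / 2) ^ n"
    by (simp add: suffix_dist_le_iff)
  also have "\<dots> \<le> max (suffix_dist x y) (suffix_dist y z)"
    using False by (auto simp: suffix_dist_def n_def min_def)
  finally show ?thesis .
qed (auto simp: suffix_dist_def)

lemma suffix_dist_nonneg: "0 \<le> suffix_dist x y"
  by (simp add: suffix_dist_def)

interpretation suffix_metric: Metric_space UNIV suffix_dist
proof
  show "suffix_dist x z \<le> suffix_dist x y + suffix_dist y z" for x y z :: "'a linf"
    using suffix_dist_ultrametric[of x z y] suffix_dist_nonneg[of x y] suffix_dist_nonneg[of y z]
    by linarith
qed (auto simp: suffix_dist_def lcs_def conj_commute)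

definition max_dist :: "'a linf \<times> 'a linf \<Rightarrow> 'a linf \<times> 'a linf \<Rightarrow> real"
  where "max_dist p q = max (suffix_dist (fst p) (fst q)) (suffix_dist (snd p) (snd q))"

interpretation max_metric: Metric_space UNIV max_dist
proof
  show "max_dist p q = 0 \<longleftrightarrow> p = q" for p q :: "'a linf \<times> 'a linf"
    using suffix_dist_nonneg[of "fst p" "fst q"] suffix_dist_nonneg[of "snd p" "snd q"]
      suffix_metric.zero[of "fst p" "fst q"] suffix_metric.zero[of "snd p" "snd q"]
    unfolding max_dist_def prod_eq_iff by (smt (verit) UNIV_I)
  show "max_dist p r \<le> max_dist p q + max_dist q r" for p q r :: "'a linf \<times> 'a linf"
    unfolding max_dist_def
    using suffix_metric.triangle[of "fst p" "fst q" "fst r"]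
      suffix_metric.triangle[of "snd p" "snd q" "snd r"] by simp linarith
qed (auto simp: max_dist_def suffix_metric.commute le_max_iff_disj)

section \<open>Right congruences\<close>

definition RC :: "('a linf \<times> 'a linf) set set"
  where "RC = {\<rho>. equiv UNIV \<rho> \<and> (\<forall>x y u. (x, y) \<in> \<rho> \<longrightarrow> (x \<cdot> u, y \<cdot> u) \<in> \<rho>)}"

definition open_RC :: "('a linf \<times> 'a linf) set set"
  where "open_RC = {\<rho> \<in> RC. openin max_metric.mtopology \<rho>}"

text \<open>
  The empty family, with intersection \<^const>\<open>UNIV\<close>, is harmless: the universal relation is
  itself an open right congruence.
\<close>

definition PRC :: "('a linf \<times> 'a linf) set set"
  where "PRC = {\<rho> \<in> RC. \<exists>F \<subseteq> open_RC. \<rho> = \<Inter>F}"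

definition tau :: "'a list set \<Rightarrow> ('a linf \<times> 'a linf) set"
  where "tau P = {(x, y). x = y \<or> (\<exists>u\<in>P. x \<in> ending_in u \<and> y \<in> ending_in u)}"

end

theory Submission
  imports Defs
begin

text \<open>
  The relation \<open>tau L\<close> is always an equivalence, since suffixes of a common word are comparable.
  If it is a right congruence, \<open>u \<in> L\<close> and \<open>v\<close> is a word, take \<open>x\<close> and \<open>y\<close> with distinct last
  letters: all common suffixes of the related words \<open>xuv\<close> and \<open>yuv\<close> are suffixes of \<open>uv\<close>, so
  \<open>uv \<in> L\<close>. Conversely, for an ideal \<open>L\<close> the sets \<open>L \<union> A\<^sup>n A\<^sup>*\<close> are ideals that
  contain a suffix of every left infinite word; hence their relations are open right congruences,
  and these intersect in \<open>tau L\<close>. The remaining equivalences follow from the fact that a left ideal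
  is generated by its suffix-minimal elements.
\<close>

lemma left_ideal_iff: "left_ideal L \<longleftrightarrow> (\<forall>u. \<forall>v\<in>L. u @ v \<in> L)"
  unfolding left_ideal_def lang_prod_def by blast

lemma left_ideal_suffix: "left_ideal L \<Longrightarrow> u \<in> L \<Longrightarrow> suffix u v \<Longrightarrow> v \<in> L"
  by (auto simp: left_ideal_iff suffix_def)

lemma two_sided_ideal_iff: "two_sided_ideal I \<longleftrightarrow> (\<forall>u. \<forall>v\<in>I. \<forall>w. u @ v @ w \<in> I)"
proof
  assume I: "two_sided_ideal I"
  have "(u @ v) @ w \<in> UNIV \<odot> I \<odot> UNIV" if "v \<in> I" for u v w
    using that unfolding lang_prod_def by blast
  with I show "\<forall>u. \<forall>v\<in>I. \<forall>w. u @ v @ w \<in> I"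
    unfolding two_sided_ideal_def by auto
qed (auto simp: two_sided_ideal_def lang_prod_def)

lemma two_sided_ideal_appendR: "two_sided_ideal I \<Longrightarrow> u \<in> I \<Longrightarrow> u @ v \<in> I"
  by (metis append_Nil two_sided_ideal_iff)

lemma two_sided_ideal_Un_long_words:
  assumes "two_sided_ideal I"
  shows "two_sided_ideal (I \<union> {u. n \<le> length u})"
  using assms by (auto simp: two_sided_ideal_iff)

text \<open>Word length makes the suffix order well-founded: among the suffixes of a word of
  \<open>L\<close> that lie in \<open>L\<close>, a shortest one is suffix-minimal.\<close>

lemma left_ideal_generated_by_suffix_minimal:
  assumes "left_ideal L"
  shows "UNIV \<odot> suffix_minimal L = L"
proof
  show "UNIV \<odot> suffix_minimal L \<subseteq> L"
    using assms by (auto simp: left_ideal_iff lang_prod_def suffix_minimal_def)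
  show "L \<subseteq> UNIV \<odot> suffix_minimal L"
  proof
    fix u assume "u \<in> L"
    then obtain v where v: "v \<in> L" "suffix v u"
      and least: "\<And>w. w \<in> L \<Longrightarrow> suffix w u \<Longrightarrow> length v \<le> length w"
      using ex_has_least_nat[of "\<lambda>v. v \<in> L \<and> suffix v u" u length] by auto
    have "v \<in> suffix_minimal L"
      unfolding suffix_minimal_def
    proof (intro CollectI conjI ballI impI)
      fix w assume w: "w \<in> L" "suffix w v"
      then have "length v \<le> length w"
        using least v(2) suffix_order.trans by blast
      then show "w = v"
        using w(2) by (auto simp: suffix_def)
    qed (fact v(1))
    with v(2) show "u \<in> UNIV \<odot> suffix_minimal L"
      by (auto simp: lang_prod_def suffix_def)
  qed
qed

text \<open>As the right-hand side of the inclusion is \<open>L\<close>, it says that a minimal word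
  followed by a letter is in \<open>L\<close>. Left multiplication carries this to all of
  \<open>L\<close>, induction on the right factor to all words.\<close>

lemma two_sided_ideal_iff_suffix_minimal:
  assumes "left_ideal L"
  shows "two_sided_ideal L \<longleftrightarrow> suffix_minimal L \<odot> letters \<subseteq> UNIV \<odot> suffix_minimal L"
proof
  assume "two_sided_ideal L"
  then show "suffix_minimal L \<odot> letters \<subseteq> UNIV \<odot> suffix_minimal L"
    unfolding left_ideal_generated_by_suffix_minimal[OF assms]
    by (auto simp: lang_prod_def suffix_minimal_def two_sided_ideal_appendR)
next
  assume sub: "suffix_minimal L \<odot> letters \<subseteq> UNIV \<odot> suffix_minimal L"
  have snoc: "u @ [a] \<in> L" if "u \<in> L" for u a
  proof -
    have "u \<in> UNIV \<odot> suffix_minimal L"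
      using that left_ideal_generated_by_suffix_minimal[OF assms] by simp
    then obtain w v where u: "u = w @ v" and v: "v \<in> suffix_minimal L"
      by (auto simp: lang_prod_def)
    have "v @ [a] \<in> L"
      using subsetD[OF sub, of "v @ [a]"] v
      unfolding left_ideal_generated_by_suffix_minimal[OF assms]
      by (auto simp: lang_prod_def letters_def)
    then show ?thesis
      using assms by (simp add: u left_ideal_iff)
  qed
  have "u @ w \<in> L" if "u \<in> L" for u w
    by (induction w rule: rev_induct) (use that snoc in \<open>auto simp flip: append_assoc\<close>)
  then show "two_sided_ideal L"
    using assms by (simp add: two_sided_ideal_iff left_ideal_iff)
qed

lemma suffix_code_suffix_minimal: "suffix_code (suffix_minimal L)"
  by (auto simp: suffix_code_def suffix_minimal_def)

text \<open>In this form any position where \<open>x\<close> and \<open>y\<close> differ bounds the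
  length of the witness \<open>u\<close>.\<close>

lemma tau_iff:
  "(x, y) \<in> tau P \<longleftrightarrow> x = y \<or> (\<exists>u\<in>P. x \<in> ending_in u \<and> (\<forall>i<length u. x i = y i))"
  by (auto simp: tau_def ending_in_iff)

lemma equiv_tau: "equiv UNIV (tau P)"
proof (rule equivI)
  show "refl (tau P)" "sym (tau P)"
    by (auto simp: tau_def refl_on_def sym_def)
  show "trans (tau P)"
  proof (rule transI)
    fix x y z assume xy: "(x, y) \<in> tau P" and yz: "(y, z) \<in> tau P"
    show "(x, z) \<in> tau P"
    proof (cases "x = y \<or> y = z")
      case False
      then obtain u v where u: "u \<in> P" "x \<in> ending_in u" "y \<in> ending_in u"
        and v: "v \<in> P" "y \<in> ending_in v" "z \<in> ending_in v"
        using xy yz by (auto simp: tau_def)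
      show ?thesis
      \<comment> \<open>Both \<open>u\<close> and \<open>v\<close> are suffixes of \<open>y\<close>,
        so the shorter one is a suffix of the longer and hence common to \<open>x\<close>,
        \<open>y\<close> and \<open>z\<close>.\<close>
      proof (cases "length u \<le> length v")
        case True
        then have "z \<in> ending_in u"
          using u(3) v(2,3) by (auto simp: ending_in_iff)
        then show ?thesis
          using u by (auto simp: tau_def)
      next
        case False
        then have "x \<in> ending_in v"
          using v(2) u(2,3) by (auto simp: ending_in_iff)
        then show ?thesis
          using v by (auto simp: tau_def)
      qed
    qed (use xy yz in auto)
  qed
qed simp

lemma ending_in_append: "x \<in> ending_in u \<Longrightarrow> x \<cdot> v \<in> ending_in (u @ v)"
  by (auto simp: ending_in_def linf_append_append)

text \<open>A common suffix \<open>u\<close> in \<open>L\<close> turns into the common suffix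
  \<open>u @ v\<close>, again in \<open>L\<close>.\<close>

lemma tau_in_RC_if_two_sided_ideal:
  assumes "two_sided_ideal L"
  shows "tau L \<in> RC"
proof -
  have "(x \<cdot> v, y \<cdot> v) \<in> tau L" if "(x, y) \<in> tau L" for x y v
    using that two_sided_ideal_appendR[OF assms] ending_in_append unfolding tau_def by blast
  then show ?thesis
    by (simp add: RC_def equiv_tau)
qed

lemma two_sided_ideal_if_tau_in_RC:
  fixes L :: "'a::finite list set"
  assumes "CARD('a) \<ge> 2" and L: "left_ideal L" and RC: "tau L \<in> RC"
  shows "two_sided_ideal L"
proof -
  obtain a b :: 'a where "a \<noteq> b"
    using assms(1) by (auto simp: numeral_2_eq_2 card_le_Suc_iff)
  have "u @ v \<in> L" if "u \<in> L" for u v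
  proof -
    \<comment> \<open>Constant words: once \<open>u @ v\<close> is appended, they first differ at
      index \<open>length (u @ v)\<close>, so no common suffix is longer than
      \<open>u @ v\<close>.\<close>
    let ?x = "\<lambda>i::nat. a" and ?y = "\<lambda>i::nat. b"
    have "(?x \<cdot> u, ?y \<cdot> u) \<in> tau L"
      using that by (auto simp: tau_def ending_in_def)
    then have "(?x \<cdot> u \<cdot> v, ?y \<cdot> u \<cdot> v) \<in> tau L"
      using RC by (simp add: RC_def)
    then have "(?x \<cdot> (u @ v), ?y \<cdot> (u @ v)) \<in> tau L"
      by (simp add: linf_append_append)
    moreover have neq: "(?x \<cdot> (u @ v)) (length (u @ v)) \<noteq> (?y \<cdot> (u @ v)) (length (u @ v))"
      using \<open>a \<noteq> b\<close> by (simp add: linf_append_def)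
    ultimately obtain w where w: "w \<in> L" "?x \<cdot> (u @ v) \<in> ending_in w"
      and agree: "\<forall>i<length w. (?x \<cdot> (u @ v)) i = (?y \<cdot> (u @ v)) i"
      unfolding tau_iff by metis
    have len: "length w \<le> length (u @ v)"
      using agree neq by (meson not_le_imp_less)
    \<comment> \<open>Index 0 is the rightmost letter, so suffixes are compared as prefixes of the
      reversed words.\<close>
    have "rev w = take (length w) (rev (u @ v))"
    proof (rule nth_equalityI)
      fix i assume "i < length (rev w)"
      then show "rev w ! i = take (length w) (rev (u @ v)) ! i"
        using w(2) len by (simp add: ending_in_iff linf_append_def del: rev_append take_append)
    qed (use len in simp)
    then have "suffix w (u @ v)"
      by (metis suffix_to_prefix take_is_prefix)
    with L w(1) show ?thesis
      by (rule left_ideal_suffix)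
  qed
  with L show ?thesis
    by (simp add: two_sided_ideal_iff left_ideal_iff)
qed

text \<open>By the assumption even a diagonal pair shares a suffix in \<open>P\<close>, and all
  sufficiently close pairs keep that suffix.\<close>

lemma openin_tau:
  assumes "\<And>x. \<exists>u\<in>P. x \<in> ending_in u"
  shows "openin max_metric.mtopology (tau P)"
  unfolding max_metric.openin_mtopology
proof (intro conjI allI impI)
  fix p assume "p \<in> tau P"
  then obtain x y where p: "p = (x, y)" and xy: "(x, y) \<in> tau P"
    by (cases p) auto
  obtain u where u: "u \<in> P" "x \<in> ending_in u" "y \<in> ending_in u"
    using xy assms[of x] by (auto simp: tau_def)
  have "max_metric.mball p ((1 / 2) ^ length u) \<subseteq> tau P"
  proof
    fix q assume "q \<in> max_metric.mball p ((1 / 2) ^ length u)"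
    then have "suffix_dist x (fst q) \<le> (1 / 2) ^ length u"
      and "suffix_dist y (snd q) \<le> (1 / 2) ^ length u"
      by (auto simp: p max_dist_def)
    then have "fst q \<in> ending_in u" "snd q \<in> ending_in u"
      using u by (auto simp: suffix_dist_le_iff ending_in_iff)
    then show "q \<in> tau P"
      using u(1) by (cases q) (auto simp: tau_def)
  qed
  then show "\<exists>r>0. max_metric.mball p r \<subseteq> tau P"
    by (intro exI[of _ "(1 / 2) ^ length u"]) simp
qed simp

lemma tau_eq_Inter_tau_Un_long_words: "tau L = (\<Inter>n. tau (L \<union> {u. n \<le> length u}))"
proof
  show "tau L \<subseteq> (\<Inter>n. tau (L \<union> {u. n \<le> length u}))"
    by (auto simp: tau_def)
  show "(\<Inter>n. tau (L \<union> {u. n \<le> length u})) \<subseteq> tau L"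
  proof (rule subrelI)
    fix x y assume xy: "(x, y) \<in> (\<Inter>n. tau (L \<union> {u. n \<le> length u}))"
    show "(x, y) \<in> tau L"
    proof (cases "x = y")
      case False
      then obtain k where k: "x k \<noteq> y k"
        by auto
      \<comment> \<open>A common suffix has length at most \<open>k\<close>, so at
        \<open>n = Suc k\<close> the witness cannot be one of the added long words and lies in
        \<open>L\<close>.\<close>
      from xy have "(x, y) \<in> tau (L \<union> {u. Suc k \<le> length u})"
        by blast
      with False k show ?thesis
        by (auto simp: tau_iff Suc_le_eq)
    qed (simp add: tau_def)
  qed
qed

lemma tau_in_PRC_if_two_sided_ideal:
  assumes "two_sided_ideal L"
  shows "tau L \<in> PRC"
proof -
  have "tau (L \<union> {u. n \<le> length u}) \<in> open_RC" for n
  proof -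
    \<comment> \<open>The suffix of \<open>x\<close> of length \<open>n\<close> is among the added
      words.\<close>
    have "\<exists>u \<in> L \<union> {u. n \<le> length u}. x \<in> ending_in u" for x
      using common_suffix_iff[of n x x] by auto
    then have "openin max_metric.mtopology (tau (L \<union> {u. n \<le> length u}))"
      by (rule openin_tau)
    then show ?thesis
      using tau_in_RC_if_two_sided_ideal[OF two_sided_ideal_Un_long_words[OF assms]]
      by (simp add: open_RC_def)
  qed
  then have "\<exists>F \<subseteq> open_RC. tau L = \<Inter>F"
    by (intro exI[of _ "range (\<lambda>n. tau (L \<union> {u. n \<le> length u}))"])
      (use tau_eq_Inter_tau_Un_long_words in blast)
  then show ?thesis
    using assms by (simp add: PRC_def tau_in_RC_if_two_sided_ideal)
qed

theorem proposition6p2: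
  fixes L :: "'a::finite list set"
  assumes "CARD('a) \<ge> 2"
    and "left_ideal L"
  shows "(tau L \<in> RC \<longleftrightarrow> tau L \<in> PRC)
    \<and> (tau L \<in> PRC \<longleftrightarrow> two_sided_ideal L)
    \<and> (two_sided_ideal L \<longleftrightarrow> suffix_minimal L \<odot> letters \<subseteq> UNIV \<odot> suffix_minimal L)
    \<and> (suffix_minimal L \<odot> letters \<subseteq> UNIV \<odot> suffix_minimal L
        \<longleftrightarrow> semaphore_code (suffix_minimal L))"
proof -
  \<comment> \<open>This closes the cycle from \<open>RC\<close> through ideals to
    \<open>PRC\<close> and back; \<open>suffix_code_suffix_minimal\<close> supplies the antichain
    half of \<open>semaphore_code\<close>.\<close>
  have "tau L \<in> RC" if "tau L \<in> PRC"
    using that by (simp add: PRC_def)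
  then show ?thesis
    using two_sided_ideal_if_tau_in_RC[OF assms] tau_in_PRC_if_two_sided_ideal[of L]
      two_sided_ideal_iff_suffix_minimal[OF assms(2)] suffix_code_suffix_minimal[of L]
    unfolding semaphore_code_def by blast
qed

end
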